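(* Let $E$ be the energy of an arbitrary discrete Markov random field (of any order), with discrete feasible set $\overline{\mathcal{X}}$ and relaxed feasible set $\mathcal{X}$ (as defined in the context). The continuous relaxation $\min_{\mathbf{x}\in\mathcal{X}} E(\mathbf{x})$ of the problem $\min_{\mathbf{x}\in\overline{\mathcal{X}}} E(\mathbf{x})$ is tight, i.e. $$\min_{\mathbf{x}\in\mathcal{X}} E(\mathbf{x}) = \min_{\mathbf{x}\in\overline{\mathcal{X}}} E(\mathbf{x}).$$
   Context: Let $\mathcal{V}=\{1,\dots,n\}$ be a finite set of nodes; each node $i$ has a finite nonempty set of labels $\mathcal{S}_i$. Let $\mathcal{C}$ be a finite set of cliques; each clique is an ordered tuple $C=(i_1,\dots,i_\alpha)$ of distinct nodes, and the single nodes are among the cliques. For each $C\in\mathcal{C}$ let $\mathcal{S}_C=\prod_{i\in C}\mathcal{S}_i$ and let $f_C:\mathcal{S}_C\to\mathbb{R}$ be a real-valued potential function. A vector $\mathbf{x}=(\mathbf{x}_1,\dots,\mathbf{x}_n)$ consists of blocks $\mathbf{x}_i=(x_i(s))_{s\in\mathcal{S}_i}\in\mathbb{R}^{|\mathcal{S}_i|}$. The energy is $$E(\mathbf{x})=\sum_{C\in\mathcal{C}}\ \sum_{s_C\in\mathcal{S}_C} f_C(s_C)\prod_{j\in C}x_j(s_j),$$ where $s_j$ denotes the component of $s_C$ at node $j$. The feasible sets are $$\overline{\mathcal{X}}=\{\mathbf{x} : \mathbf{1}^\top\mathbf{x}_i=1,\ \mathbf{x}_i\in\{0,1\}^{|\mathcal{S}_i|}\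 \forall i\in\mathcal{V}\},\qquad \mathcal{X}=\{\mathbf{x} : \mathbf{1}^\top\mathbf{x}_i=1,\ \mathbf{x}_i\ge\mathbf{0}\ \forall i\in\mathcal{V}\},$$ where inequalities are componentwise. "Tight" means that the relaxed problem and the discrete problem have the same optimal value. *)

theory Defs
  imports Complex_Main "HOL-Library.FuncSet"
begin

text \<open>
  The blocks of a vector live in \<open>PiE (S i) (\<lambda>_. UNIV)\<close>, the function-space rendering of
  the real vectors indexed by \<open>S i\<close>.  Extensionality pins the values outside the index sets
  to \<open>undefined\<close>, so two vectors are equal iff all their entries are.
\<close>

definition block_vectors :: "nat \<Rightarrow> (nat \<Rightarrow> 'l set) \<Rightarrow> (nat \<Rightarrow> 'l \<Rightarrow> real) set" where
  "block_vectors n S = (\<Pi>\<^sub>E i\<in>{1..n}. \<Pi>\<^sub>E s\<in>S i. UNIV)"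

definition discrete_feasible :: "nat \<Rightarrow> (nat \<Rightarrow> 'l set) \<Rightarrow> (nat \<Rightarrow> 'l \<Rightarrow> real) set" where
  "discrete_feasible n S = {x \<in> block_vectors n S.
     \<forall>i\<in>{1..n}. (\<Sum>s\<in>S i. x i s) = 1 \<and> (\<forall>s\<in>S i. x i s \<in> {0, 1})}"

definition relaxed_feasible :: "nat \<Rightarrow> (nat \<Rightarrow> 'l set) \<Rightarrow> (nat \<Rightarrow> 'l \<Rightarrow> real) set" where
  "relaxed_feasible n S = {x \<in> block_vectors n S.
     \<forall>i\<in>{1..n}. (\<Sum>s\<in>S i. x i s) = 1 \<and> (\<forall>s\<in>S i. x i s \<ge> 0)}"

text \<open>
  A clique is a list of distinct nodes.  An element of its joint label set is a family indexed
  by the nodes of the clique, so that \<open>s j\<close> is the component at node \<open>j\<close>.  Different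
  orderings of the same nodes are different cliques, each with its own potential \<open>f C\<close>.
\<close>

definition clique_labels :: "(nat \<Rightarrow> 'l set) \<Rightarrow> nat list \<Rightarrow> (nat \<Rightarrow> 'l) set" where
  "clique_labels S C = (\<Pi>\<^sub>E i\<in>set C. S i)"

definition energy ::
  "(nat \<Rightarrow> 'l set) \<Rightarrow> nat list set \<Rightarrow> (nat list \<Rightarrow> (nat \<Rightarrow> 'l) \<Rightarrow> real) \<Rightarrow> (nat \<Rightarrow> 'l \<Rightarrow> real) \<Rightarrow> real" where
  "energy S \<C> f x = (\<Sum>C\<in>\<C>. \<Sum>s\<in>clique_labels S C. f C s * (\<Prod>j\<in>set C. x j (s j)))"

end

theory Submission
  imports Defs
begin

text \<open>
  The energy is affine in each block, so replacing block \<open>k\<close> of a relaxed point by the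
  unit vectors of \<open>S k\<close> expresses its energy as a convex combination of the energies of
  the resulting points.  One of them does not increase the energy, and rounding the blocks one after
  the other ends in a discrete point.
\<close>

text \<open>A vertex of the probability simplex over \<open>A\<close>. The restricted lambda keeps
  it extensional, as membership in \<open>block_vectors\<close> demands.\<close>

definition unit_block :: "'l set \<Rightarrow> 'l \<Rightarrow> 'l \<Rightarrow> real" where
  "unit_block A a = (\<lambda>s\<in>A. if s = a then 1 else 0)"

lemma sum_unit_block:
  assumes "finite A" "a \<in> A"
  shows "(\<Sum>s\<in>A. unit_block A a s) = 1"
  using assms by (simp add: unit_block_def)

lemma sum_mult_unit_block:
  assumes "finite A" "t \<in> A"
  shows "(\<Sum>a\<in>A. w a * unit_block A a t) = w t"
  using assms by (simp add: unit_block_def if_distrib[where f = "(*) (w _)"] cong: if_cong)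

text \<open>The product runs over the set of nodes, so block \<open>k\<close> enters at most once.
  If it enters, the unit vectors select the summand \<open>a = s k\<close>; if not, the product is
  the same for every \<open>a\<close> and the weights sum to 1.\<close>

lemma prod_eq_sum_update_block:
  fixes x :: "nat \<Rightarrow> 'l \<Rightarrow> real"
  assumes "finite (S k)" "(\<Sum>a\<in>S k. x k a) = 1" "s \<in> clique_labels S C"
  shows "(\<Prod>j\<in>set C. x j (s j)) =
    (\<Sum>a\<in>S k. x k a * (\<Prod>j\<in>set C. (x(k := unit_block (S k) a)) j (s j)))"
proof (cases "k \<in> set C")
  case False
  have "(\<Prod>j\<in>set C. (x(k := unit_block (S k) a)) j (s j)) = (\<Prod>j\<in>set C. x j (s j))" for a
    using False by (intro prod.cong) auto
  then show ?thesis
    using assms(2) by (simp flip: sum_distrib_right)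
next
  case True
  let ?P = "\<Prod>j\<in>set C - {k}. x j (s j)"
  have sk: "s k \<in> S k"
    using assms(3) True by (auto simp: clique_labels_def)
  have "(\<Prod>j\<in>set C. (x(k := unit_block (S k) a)) j (s j)) = unit_block (S k) a (s k) * ?P" for a
    using True by (subst prod.remove[of _ k]) auto
  moreover have "(\<Prod>j\<in>set C. x j (s j)) = x k (s k) * ?P"
    using True by (subst prod.remove[of _ k]) auto
  ultimately show ?thesis
    using sum_mult_unit_block[OF assms(1) sk, of "x k"]
    by (simp add: mult.assoc[symmetric] flip: sum_distrib_right)
qed

text \<open>The weights \<open>x k a\<close> are the same for every clique and every labelling, so
  the identity for single products passes to their linear combination by exchanging sums.\<close>

lemma energy_eq_sum_update_block:
  assumes "finite (S k)" "(\<Sum>a\<in>S k. x k a) = 1"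
  shows "energy S \<C> f x = (\<Sum>a\<in>S k. x k a * energy S \<C> f (x(k := unit_block (S k) a)))"
proof -
  let ?p = "\<lambda>y C s. \<Prod>j\<in>set C. y j (s j)"
  let ?y = "\<lambda>a. x(k := unit_block (S k) a)"
  have "energy S \<C> f x =
      (\<Sum>C\<in>\<C>. \<Sum>s\<in>clique_labels S C. f C s * (\<Sum>a\<in>S k. x k a * ?p (?y a) C s))"
    unfolding energy_def
    by (intro sum.cong refl arg_cong2[where f = "(*)"] prod_eq_sum_update_block assms)
  also have "\<dots> = (\<Sum>C\<in>\<C>. \<Sum>s\<in>clique_labels S C. \<Sum>a\<in>S k. x k a * (f C s * ?p (?y a) C s))"
    by (simp only: sum_distrib_left mult.left_commute)
  also have "\<dots> = (\<Sum>C\<in>\<C>. \<Sum>a\<in>S k. \<Sum>s\<in>clique_labels S C. x k a * (f C s * ?p (?y a) C s))"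
    by (intro sum.cong refl sum.swap)
  also have "\<dots> = (\<Sum>a\<in>S k. \<Sum>C\<in>\<C>. \<Sum>s\<in>clique_labels S C. x k a * (f C s * ?p (?y a) C s))"
    by (rule sum.swap)
  also have "\<dots> = (\<Sum>a\<in>S k. x k a * energy S \<C> f (?y a))"
    by (simp only: energy_def sum_distrib_left)
  finally show ?thesis .
qed

text \<open>A weighted mean cannot lie strictly below all the values that it averages.\<close>

lemma ex_le_convex_combination:
  fixes w g :: "'l \<Rightarrow> real"
  assumes "\<And>a. a \<in> A \<Longrightarrow> 0 \<le> w a" "sum w A = 1"
  shows "\<exists>a\<in>A. g a \<le> (\<Sum>a\<in>A. w a * g a)"
proof (rule ccontr)
  let ?m = "\<Sum>a\<in>A. w a * g a"
  assume "\<not> ?thesis"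
  then have less: "?m < g a" if "a \<in> A" for a
    using that by auto
  \<comment> \<open>A sum over an infinite set defaults to 0, which differs from 1.\<close>
  have fin: "finite A"
    using assms(2) by (rule contrapos_pp) simp
  obtain b where b: "b \<in> A" "w b \<noteq> 0"
    using assms(2) by (metis sum.neutral zero_neq_one)
  \<comment> \<open>Termwise \<open>w a * ?m \<le> w a * g a\<close>, and the inequality is strict
    at \<open>b\<close>, where the weight is positive. Since the weights sum to 1, the left side is
    \<open>?m\<close> itself.\<close>
  have "(\<Sum>a\<in>A. w a * ?m) < ?m"
    by (rule sum_strict_mono_ex1[OF fin])
       (use b less assms(1) in \<open>auto intro!: mult_left_mono bexI[of _ b] simp: less_le\<close>)
  then show False
    using assms(2) by (simp flip: sum_distrib_right)
qed

lemma update_block_relaxed_feasible: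
  assumes "x \<in> relaxed_feasible n S" "k \<in> {1..n}" "finite (S k)" "a \<in> S k"
  shows "x(k := unit_block (S k) a) \<in> relaxed_feasible n S"
  using assms sum_unit_block[OF assms(3,4)]
  by (auto simp: relaxed_feasible_def block_vectors_def unit_block_def PiE_iff extensional_def)

text \<open>Induction on the number of rounded blocks: rounding block \<open>Suc m\<close> leaves
  the earlier blocks untouched, so their entries stay 0 or 1, and the energy bounds chain by
  transitivity.\<close>

lemma exists_rounded_prefix:
  assumes "\<And>i. i \<in> {1..n} \<Longrightarrow> finite (S i)" "x \<in> relaxed_feasible n S" "m \<le> n"
  shows "\<exists>y\<in>relaxed_feasible n S. energy S \<C> f y \<le> energy S \<C> f x \<and>
    (\<forall>i\<in>{1..m}. \<forall>s\<in>S i. y i s \<in> {0, 1})"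
  using assms(3)
proof (induction m)
  case 0
  then show ?case
    using assms(2) by auto
next
  case (Suc m)
  then obtain y where y: "y \<in> relaxed_feasible n S" "energy S \<C> f y \<le> energy S \<C> f x"
      "\<forall>i\<in>{1..m}. \<forall>s\<in>S i. y i s \<in> {0, 1}"
    by auto
  let ?k = "Suc m"
  have k: "?k \<in> {1..n}"
    using Suc.prems by simp
  then have fin: "finite (S ?k)"
    by (rule assms(1))
  have w: "\<And>a. a \<in> S ?k \<Longrightarrow> 0 \<le> y ?k a" "(\<Sum>a\<in>S ?k. y ?k a) = 1"
    using y(1) k by (auto simp: relaxed_feasible_def)
  let ?z = "\<lambda>a. y(?k := unit_block (S ?k) a)"
  \<comment> \<open>The entries of block \<open>?k\<close> of \<open>y\<close> serve as the convex
    weights, and the resulting mean of the energies of the \<open>?z a\<close> is the energy of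
    \<open>y\<close>.\<close>
  obtain a where a: "a \<in> S ?k" "energy S \<C> f (?z a) \<le> energy S \<C> f y"
    using ex_le_convex_combination[OF w, of "\<lambda>a. energy S \<C> f (?z a)"]
      energy_eq_sum_update_block[of S ?k y \<C> f, OF fin w(2)] by auto
  have "\<forall>i\<in>{1..?k}. \<forall>s\<in>S i. ?z a i s \<in> {0, 1}"
    using y(3) by (auto simp: unit_block_def le_Suc_eq)
  moreover have "?z a \<in> relaxed_feasible n S"
    using y(1) k fin a(1) by (rule update_block_relaxed_feasible)
  ultimately show ?case
    using a(2) y(2) by (meson order_trans)
qed

lemma discrete_subset_relaxed: "discrete_feasible n S \<subseteq> relaxed_feasible n S"
  by (force simp: discrete_feasible_def relaxed_feasible_def)

lemma exists_discrete_energy_le: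
  assumes "\<And>i. i \<in> {1..n} \<Longrightarrow> finite (S i)" "x \<in> relaxed_feasible n S"
  shows "\<exists>y\<in>discrete_feasible n S. energy S \<C> f y \<le> energy S \<C> f x"
  using exists_rounded_prefix[OF assms order_refl, where \<C> = \<C> and f = f]
  unfolding relaxed_feasible_def discrete_feasible_def by blast

text \<open>Extensionality fixes all values outside the index sets, which leaves a finite product of
  copies of {0, 1}.\<close>

lemma finite_discrete_feasible:
  assumes "\<And>i. i \<in> {1..n} \<Longrightarrow> finite (S i)"
  shows "finite (discrete_feasible n S)"
proof (rule finite_subset)
  show "discrete_feasible n S \<subseteq> (\<Pi>\<^sub>E i\<in>{1..n}. \<Pi>\<^sub>E s\<in>S i. {0, 1})"
    by (auto simp: discrete_feasible_def block_vectors_def PiE_iff extensional_def)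
  show "finite (\<Pi>\<^sub>E i\<in>{1..n}. \<Pi>\<^sub>E s\<in>S i. {0, 1 :: real})"
    using assms by (intro finite_PiE) auto
qed

lemma discrete_feasible_nonempty:
  assumes "\<And>i. i \<in> {1..n} \<Longrightarrow> finite (S i) \<and> S i \<noteq> {}"
  shows "discrete_feasible n S \<noteq> {}"
proof -
  obtain a where a: "\<And>i. i \<in> {1..n} \<Longrightarrow> a i \<in> S i"
    using assms by (meson some_in_eq)
  \<comment> \<open>The labelling that assigns \<open>a i\<close> to node \<open>i\<close>, encoded
    by unit vectors.\<close>
  have "(\<lambda>i\<in>{1..n}. unit_block (S i) (a i)) \<in> discrete_feasible n S"
    using assms a sum_unit_block
    by (auto simp: discrete_feasible_def block_vectors_def PiE_iff)
       (auto simp: unit_block_def)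
  then show ?thesis
    by blast
qed

theorem theorem1:
  fixes n :: nat
    and S :: "nat \<Rightarrow> 'l set"
    and \<C> :: "nat list set"
    and f :: "nat list \<Rightarrow> (nat \<Rightarrow> 'l) \<Rightarrow> real"
  assumes labels: "\<And>i. i \<in> {1..n} \<Longrightarrow> finite (S i) \<and> S i \<noteq> {}"
    and finite_cliques: "finite \<C>"
    and cliques: "\<And>C. C \<in> \<C> \<Longrightarrow> distinct C \<and> set C \<subseteq> {1..n}"
    and single_nodes: "\<And>i. i \<in> {1..n} \<Longrightarrow> [i] \<in> \<C>"
  shows "(\<exists>x. is_arg_min (energy S \<C> f) (\<lambda>x. x \<in> relaxed_feasible n S) x) \<and>
         (\<exists>x. is_arg_min (energy S \<C> f) (\<lambda>x. x \<in> discrete_feasible n S) x) \<and>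
         (INF x\<in>relaxed_feasible n S. energy S \<C> f x)
           = (INF x\<in>discrete_feasible n S. energy S \<C> f x)"
proof -
  let ?E = "energy S \<C> f" and ?R = "relaxed_feasible n S" and ?D = "discrete_feasible n S"
  have fin: "\<And>i. i \<in> {1..n} \<Longrightarrow> finite (S i)"
    using labels by blast
  obtain d where d: "is_arg_min ?E (\<lambda>x. x \<in> ?D) d"
    using ex_is_arg_min_if_finite[OF finite_discrete_feasible discrete_feasible_nonempty]
      fin labels by metis
  then have dD: "d \<in> ?D" and d_le: "\<And>y. y \<in> ?D \<Longrightarrow> ?E d \<le> ?E y"
    by (auto simp: is_arg_min_linorder)
  have dR: "d \<in> ?R"
    using dD discrete_subset_relaxed by blast
  \<comment> \<open>Rounding \<open>y\<close> gives a discrete point of no larger energy, and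
    \<open>d\<close> is minimal among those; so \<open>d\<close> solves both problems.\<close>
  have d_le_R: "?E d \<le> ?E y" if "y \<in> ?R" for y
    using exists_discrete_energy_le[OF fin that, where \<C> = \<C> and f = f] d_le
    by (meson order_trans)
  have "is_arg_min ?E (\<lambda>x. x \<in> ?R) d"
    using dR d_le_R by (auto simp: is_arg_min_linorder)
  \<comment> \<open>The infimum of a set of reals is meaningful only for nonempty sets bounded
    below; here the minimum is attained at \<open>d\<close>, so it equals the infimum.\<close>
  moreover have "(INF x\<in>?R. ?E x) = ?E d"
    using dR d_le_R by (intro cInf_eq_minimum) auto
  moreover have "(INF x\<in>?D. ?E x) = ?E d"
    using dD d_le by (intro cInf_eq_minimum) auto
  ultimately show ?thesis
    using d by metis
qed

end
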